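(* Let $\mathbb{A}\in\mathbb{M}_{d,d'}$ be partitioned into $r$ blocks $A_k\in\mathbb{M}_{n_k,m_k}$, $k=1,\ldots,r$, and assume that the partitioning is row compatible or column compatible. Then, for all Schatten $q$-norms with $q\ge 2$, $$r^{\frac{2}{q}-1}\sum_{k=1}^r\|A_k\|_q^2\ \le\ \|\mathbb{A}\|_q^2\ \le\ \sum_{k=1}^r\|A_k\|_q^2.$$ These two inequalities are reversed for $2>q>0$, that is, for $0<q<2$, $$r^{\frac{2}{q}-1}\sum_{k=1}^r\|A_k\|_q^2\ \ge\ \|\mathbb{A}\|_q^2\ \ge\ \sum_{k=1}^r\|A_k\|_q^2.$$
   Context: $\mathbb{M}_{n,m}$ is the space of complex $n\times m$ matrices. For $S\in\mathbb{M}_{n,m}$ and $0<q<\infty$, $\|S\|_q=(\mathrm{Tr}\,|S|^q)^{1/q}$ with $|S|=(S^*S)^{1/2}$ (Schatten $q$-norm; only a quasi-norm for $q<1$). A partitioning of $\mathbb{A}$ into blocks $A_1,\dots,A_r$ is a decomposition of the rectangular array of entries of $\mathbb{A}$ into pairwise disjoint nonempty rectangular blocks (submatrices formed by consecutive rows and consecutive columns) covering all entries; each $A_k$ is regarded both as an $n_k\times m_k$ matrix and as a submatrix with its position in $\mathbb{A}$. The partitioning is column compatible if for all $k,l$ either $A_k$ and $A_l$ lie on the same set of columns of $\mathbb{A}$ or they lie on disjoint sets of columns. It is row compatible if for all $k,l$ either $A_k$ and $A_l$ lie on the same set of rows of $\mathbb{A}$ or they lie on disjoint sets of rows. *)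

theory Defs
  imports
    Complex_Main
    "HOL-Library.Disjoint_Sets"
    "Jordan_Normal_Form.Schur_Decomposition"
    "Jordan_Normal_Form.DL_Submatrix"
begin

definition mat_trace :: "complex mat \<Rightarrow> complex" where
  "mat_trace M = (\<Sum>i<dim_row M. M $$ (i, i))"

definition unitary_mat :: "nat \<Rightarrow> complex mat \<Rightarrow> bool" where
  "unitary_mat n U \<longleftrightarrow> U \<in> carrier_mat n n \<and> mat_adjoint U * U = 1\<^sub>m n"

text \<open>\<open>psd_powr P s\<close> is the power \<open>P^s\<close> of a positive semidefinite matrix in the sense of the
  functional calculus: diagonalise \<open>P\<close> by a unitary matrix and raise the (nonnegative)
  eigenvalues to the power \<open>s\<close>.  As \<open>0 powr s = 0\<close>, the kernel of \<open>P\<close> is kept for \<open>s > 0\<close>;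
  only positive exponents are of interest.  The lemma \<open>psd_powr_eqI\<close> shows that
  the result does not depend on the diagonalisation.\<close>

definition psd_diagonalisation :: "complex mat \<Rightarrow> nat \<Rightarrow> complex mat \<Rightarrow> (nat \<Rightarrow> real) \<Rightarrow> bool" where
  "psd_diagonalisation P n U e \<longleftrightarrow>
     unitary_mat n U \<and> (\<forall>i<n. 0 \<le> e i) \<and>
     P = U * mat_diag n (\<lambda>i. complex_of_real (e i)) * mat_adjoint U"

definition psd_powr :: "complex mat \<Rightarrow> real \<Rightarrow> complex mat" where
  "psd_powr P s = (THE B. \<exists>n U e. psd_diagonalisation P n U e \<and>
     B = U * mat_diag n (\<lambda>i. complex_of_real (e i powr s)) * mat_adjoint U)"

definition mat_abs :: "complex mat \<Rightarrow> complex mat" where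
  "mat_abs S = psd_powr (mat_adjoint S * S) (1/2)"

definition schatten_norm :: "real \<Rightarrow> complex mat \<Rightarrow> real" where
  "schatten_norm q S = Re (mat_trace (psd_powr (mat_abs S) q)) powr (1/q)"

lemma mat_adjoint_carrier: "A \<in> carrier_mat n m \<Longrightarrow> mat_adjoint A \<in> carrier_mat m n"
  unfolding mat_adjoint_def by auto

lemma psd_powr_unique:
  assumes "psd_diagonalisation P n U d" and "psd_diagonalisation P k V e"
  shows "U * mat_diag n (\<lambda>i. complex_of_real (d i powr s)) * mat_adjoint U =
         V * mat_diag k (\<lambda>i. complex_of_real (e i powr s)) * mat_adjoint V"
proof -
  have U: "U \<in> carrier_mat n n" "mat_adjoint U * U = 1\<^sub>m n"
    and P1: "P = U * mat_diag n (\<lambda>i. complex_of_real (d i)) * mat_adjoint U"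
    using assms(1) by (auto simp: psd_diagonalisation_def unitary_mat_def)
  have V0: "V \<in> carrier_mat k k" "mat_adjoint V * V = 1\<^sub>m k"
    and P2: "P = V * mat_diag k (\<lambda>i. complex_of_real (e i)) * mat_adjoint V"
    using assms(2) by (auto simp: psd_diagonalisation_def unitary_mat_def)
  have "dim_row P = n" unfolding P1 using U(1) by simp
  moreover have "dim_row P = k" unfolding P2 using V0(1) by simp
  ultimately have k: "k = n" by simp
  note V = V0[unfolded k]
  note P2 = P2[unfolded k]
  let ?U = "mat_adjoint U" and ?V = "mat_adjoint V"
  have U': "?U \<in> carrier_mat n n" and V': "?V \<in> carrier_mat n n"
    using U V by (auto intro: mat_adjoint_carrier)
  have UU: "U * ?U = 1\<^sub>m n" using mat_mult_left_right_inverse[OF U' U(1) U(2)] .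
  have VV: "V * ?V = 1\<^sub>m n" using mat_mult_left_right_inverse[OF V' V(1) V(2)] .
  define W where "W = ?V * U"
  have W: "W \<in> carrier_mat n n" using U V' by (auto simp: W_def)
  have conj: "?V * (X * Y * Z) * U = (?V * X) * Y * (Z * U)"
    if "X \<in> carrier_mat n n" "Y \<in> carrier_mat n n" "Z \<in> carrier_mat n n" for X Y Z
  proof -
    have "?V * (X * Y * Z) * U = ?V * (X * (Y * (Z * U)))"
      using that U(1) V' by (simp add: assoc_mult_mat[of _ n n _ n _ n])
    also have "\<dots> = (?V * X) * Y * (Z * U)"
      using that U(1) V' by (simp add: assoc_mult_mat[of _ n n _ n _ n])
    finally show ?thesis .
  qed
  have L: "?V * (U * mat_diag n f * ?U) * U = W * mat_diag n f" for f
  proof -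
    have "?V * (U * mat_diag n f * ?U) * U = W * mat_diag n f * 1\<^sub>m n"
      by (subst conj) (use U U' in \<open>auto simp: W_def\<close>)
    then show ?thesis using W by (simp add: right_mult_one_mat[of _ n n])
  qed
  have R: "?V * (V * mat_diag n f * ?V) * U = mat_diag n f * W" for f
  proof -
    have "?V * (V * mat_diag n f * ?V) * U = 1\<^sub>m n * mat_diag n f * W"
      by (subst conj) (use V V' in \<open>auto simp: W_def\<close>)
    then show ?thesis by (simp add: left_mult_one_mat[of _ n n])
  qed
  have "W * mat_diag n (\<lambda>i. complex_of_real (d i)) = mat_diag n (\<lambda>i. complex_of_real (e i)) * W"
    using L R P1 P2 by metis
  then have M: "mat n n (\<lambda>(i,j). W $$ (i,j) * complex_of_real (d j)) =
      mat n n (\<lambda>(i,j). complex_of_real (e i) * W $$ (i,j))"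
    by (simp add: mat_diag_mult_right[OF W] mat_diag_mult_left[OF W])
  have "W $$ (i,j) * complex_of_real (d j) = complex_of_real (e i) * W $$ (i,j)"
    if "i < n" "j < n" for i j
    using arg_cong[OF M, of "\<lambda>M. M $$ (i,j)"] that by simp
  then have "W $$ (i,j) = 0 \<or> d j = e i" if "i < n" "j < n" for i j
    using that by (metis mult.commute mult_cancel_left of_real_eq_iff)
  then have "W * mat_diag n (\<lambda>i. complex_of_real (d i powr s)) =
      mat_diag n (\<lambda>i. complex_of_real (e i powr s)) * W"
    unfolding mat_diag_mult_right[OF W] mat_diag_mult_left[OF W]
    by (intro eq_matI) fastforce+
  then have eq: "?V * (U * mat_diag n (\<lambda>i. complex_of_real (d i powr s)) * ?U) * U =
      ?V * (V * mat_diag n (\<lambda>i. complex_of_real (e i powr s)) * ?V) * U" (is "?V * ?X * U = ?V * ?Y * U")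
    using L R by metis
  have X: "?X \<in> carrier_mat n n" and Y: "?Y \<in> carrier_mat n n"
    using U V U' V' by auto
  have undo: "V * (?V * Z * U) * ?U = Z" if Z: "Z \<in> carrier_mat n n" for Z
  proof -
    have "V * (?V * Z * U) * ?U = (V * ?V) * Z * (U * ?U)"
    proof -
      have "V * (?V * Z * U) * ?U = V * (?V * (Z * (U * ?U)))"
        using Z U(1) V(1) U' V' by (simp add: assoc_mult_mat[of _ n n _ n _ n])
      also have "\<dots> = (V * ?V) * Z * (U * ?U)"
        using Z U(1) V(1) U' V' by (simp add: assoc_mult_mat[of _ n n _ n _ n])
      finally show ?thesis .
    qed
    then show ?thesis using Z UU VV by simp
  qed
  show ?thesis using undo[OF X] undo[OF Y] eq k by metis
qed

lemma psd_powr_eqI: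
  assumes "psd_diagonalisation P n U e"
  shows "psd_powr P s = U * mat_diag n (\<lambda>i. complex_of_real (e i powr s)) * mat_adjoint U"
  unfolding psd_powr_def using assms by (blast intro: psd_powr_unique the_equality)

text \<open>The \<open>k\<close>-th block occupies the rows \<open>R k\<close> and the columns \<open>C k\<close>
  (rows and columns are numbered from \<open>0\<close>, blocks from \<open>1\<close>).\<close>

definition block_partition ::
  "nat \<Rightarrow> nat \<Rightarrow> nat \<Rightarrow> (nat \<Rightarrow> nat set) \<Rightarrow> (nat \<Rightarrow> nat set) \<Rightarrow> bool" where
  "block_partition d d' r R C \<longleftrightarrow>
     (\<forall>k\<in>{1..r}. \<exists>a b. a < b \<and> R k = {a..<b}) \<and>
     (\<forall>k\<in>{1..r}. \<exists>a b. a < b \<and> C k = {a..<b}) \<and>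
     disjoint_family_on (\<lambda>k. R k \<times> C k) {1..r} \<and>
     (\<Union>k\<in>{1..r}. R k \<times> C k) = {..<d} \<times> {..<d'}"

definition row_compatible :: "nat \<Rightarrow> (nat \<Rightarrow> nat set) \<Rightarrow> bool" where
  "row_compatible r R \<longleftrightarrow> (\<forall>k\<in>{1..r}. \<forall>l\<in>{1..r}. R k = R l \<or> R k \<inter> R l = {})"

definition column_compatible :: "nat \<Rightarrow> (nat \<Rightarrow> nat set) \<Rightarrow> bool" where
  "column_compatible r C \<longleftrightarrow> (\<forall>k\<in>{1..r}. \<forall>l\<in>{1..r}. C k = C l \<or> C k \<inter> C l = {})"

end

theory Submission
  imports Defs "HOL-Analysis.Convex" "Jordan_Normal_Form.Spectral_Radius"
begin

text \<open>Put \<open>p = q/2\<close> and let \<open>T A = Tr (A^* A)^p\<close> (\<open>gram_trace\<close>), so that the squared Schatten norm of \<open>A\<close>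
  is \<open>(T A)^(1/p)\<close> (\<open>schatten_norm_sq\<close>).  Consider \<open>p \<ge> 1\<close>; for \<open>p \<le> 1\<close> the power is concave
  and every inequality is reversed.

  Everything rests on one consequence of Jensen's inequality (\<open>compression_powr_le_gram_trace\<close>): for each
  orthonormal basis \<open>v\<close>, the sum of \<open>\<parallel>A v_l\<parallel>^(2p)\<close> is at most \<open>T A\<close>, because the numbers \<open>\<parallel>A v_l\<parallel>^2\<close> are
  doubly stochastic averages of the eigenvalues of \<open>A^* A\<close>; equality holds for a basis of eigenvectors.

  If the columns of \<open>A\<close> are divided into strips, a basis composed of eigenvectors for the single
  strips gives \<open>\<Sum> T(strip) \<le> T A\<close> (\<open>gram_trace_superadditive_columns\<close>).  If the rows are divided, the
  squared length of \<open>A v\<close> is the sum of those of its pieces, and Minkowski's inequality in an eigenbasis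
  gives \<open>(T A)^(1/p) \<le> \<Sum> T(strip)^(1/p)\<close> (\<open>gram_trace_minkowski_rows\<close>).  Since \<open>T\<close> takes the same
  value at \<open>A\<close> and at its adjoint (\<open>gram_trace_adj\<close>), both inequalities hold for divisions of rows and
  of columns.

  A column compatible partitioning arises by dividing the columns and then dividing the rows of each
  strip separately, so both inequalities extend to the blocks by applying them twice
  (\<open>gram_trace_column_compatible\<close>), and the row compatible case follows by taking adjoints.  The Minkowski
  inequality is the upper bound.  For the lower bound, superadditivity of \<open>T\<close> is followed by the power
  mean inequality, which turns the sum of the \<open>T A_k\<close> into that of the \<open>(T A_k)^(1/p)\<close> at the cost of the
  factor \<open>r^(1/p - 1)\<close> (\<open>power_mean_powr\<close>).\<close>

section \<open>Power inequalities with a direction depending on the exponent\<close>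

text \<open>The convexity of \<open>t \<mapsto> t powr p\<close> for \<open>p \<ge> 1\<close> turns into concavity for \<open>p \<le> 1\<close>, and every
  estimate below turns around with it.  Writing the estimates in the order \<open>powr_le p\<close>, whose direction
  depends on the exponent, allows one proof for both ranges.\<close>

definition powr_le :: "real \<Rightarrow> real \<Rightarrow> real \<Rightarrow> bool" where
  "powr_le p x y \<longleftrightarrow> (if 1 \<le> p then x \<le> y else y \<le> x)"

lemma powr_le_refl [simp]: "powr_le p x x"
  by (simp add: powr_le_def)

lemma powr_le_trans [trans]: "powr_le p x y \<Longrightarrow> powr_le p y z \<Longrightarrow> powr_le p x z"
  by (auto simp: powr_le_def split: if_splits)

lemma powr_le_sum: "(\<And>i. i \<in> S \<Longrightarrow> powr_le p (f i) (g i)) \<Longrightarrow> powr_le p (sum f S) (sum g S)"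
  by (auto simp: powr_le_def intro: sum_mono)

lemma powr_le_mult_left: "powr_le p x y \<Longrightarrow> 0 \<le> c \<Longrightarrow> powr_le p (c * x) (c * y)"
  by (auto simp: powr_le_def mult_left_mono)

lemma powr_le_powr:
  "powr_le p x y \<Longrightarrow> 0 \<le> x \<Longrightarrow> 0 \<le> y \<Longrightarrow> 0 \<le> s \<Longrightarrow> powr_le p (x powr s) (y powr s)"
  by (auto simp: powr_le_def intro: powr_mono2)

lemma convex_powr_nonneg:
  fixes p :: real assumes "1 \<le> p"
  shows "convex_on {0..} (\<lambda>x. x powr p)"
proof
  fix t x y :: real assume t: "0 < t" "t < 1" and xy: "x \<in> {0..}" "y \<in> {0..}"
  \<comment> \<open>convexity along a segment that ends at the origin, where no second derivative is available\<close>
  have small: "(c * z) powr p \<le> c * z powr p" if "0 \<le> c" "c \<le> 1" "0 \<le> z" for c z :: real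
  proof -
    have "c powr p \<le> c powr 1" using that assms powr_mono'[of 1 p c] by (cases "c = 0") auto
    then show ?thesis using that by (simp add: powr_mult mult_right_mono)
  qed
  show "((1 - t) *\<^sub>R x + t *\<^sub>R y) powr p \<le> (1 - t) * x powr p + t * y powr p"
  proof (cases "x = 0 \<or> y = 0")
    case True
    then show ?thesis using small[of t y] small[of "1 - t" x] t xy by auto
  next
    case False
    then show ?thesis using convex_onD[OF powr_convex[OF assms], of t x y] t xy by auto
  qed
qed simp

lemma jensen_powr:
  fixes w x :: "'a \<Rightarrow> real"
  assumes p: "0 < p" and S: "finite S" "\<And>i. i \<in> S \<Longrightarrow> 0 \<le> w i" "sum w S = 1"
    and x: "\<And>i. i \<in> S \<Longrightarrow> 0 \<le> x i"
  shows "powr_le p ((\<Sum>i\<in>S. w i * x i) powr p) (\<Sum>i\<in>S. w i * x i powr p)"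
proof -
  have ne: "S \<noteq> {}" using S(3) by auto
  have J: "(\<Sum>i\<in>S. w i * y i) powr s \<le> (\<Sum>i\<in>S. w i * y i powr s)"
    if "1 \<le> s" "\<And>i. i \<in> S \<Longrightarrow> 0 \<le> y i" for s y
    using convex_on_sum[OF S(1) ne convex_powr_nonneg[OF that(1)] S(3), of y] S(2) that(2) by auto
  show ?thesis
  proof (cases "1 \<le> p")
    case True
    then show ?thesis using J[of p x] x by (auto simp: powr_le_def)
  next
    case False
    \<comment> \<open>concavity of the power follows from convexity of its inverse \<open>t powr (1/p)\<close>\<close>
    have "(\<Sum>i\<in>S. w i * x i powr p) powr (1/p) \<le> (\<Sum>i\<in>S. w i * (x i powr p) powr (1/p))"
      using J[of "1/p" "\<lambda>i. x i powr p"] p False by auto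
    also have "\<dots> = (\<Sum>i\<in>S. w i * x i)"
      using p x by (auto simp: powr_powr intro!: sum.cong)
    finally have "((\<Sum>i\<in>S. w i * x i powr p) powr (1/p)) powr p \<le> (\<Sum>i\<in>S. w i * x i) powr p"
      using p by (intro powr_mono2) auto
    moreover have "0 \<le> (\<Sum>i\<in>S. w i * x i powr p)" using S(2) by (intro sum_nonneg) auto
    ultimately show ?thesis using False p by (simp add: powr_le_def powr_powr)
  qed
qed

text \<open>If \<open>x\<close> lists the eigenvalues of a positive semidefinite matrix, the diagonal of that matrix in another
  orthonormal basis is a doubly stochastic average of \<open>x\<close>.  Jensen's inequality applies to each
  row, and the column sums make the total come out without weights.\<close>

lemma powr_le_doubly_stochastic:
  fixes w :: "'a \<Rightarrow> 'b \<Rightarrow> real"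
  assumes p: "0 < p" and fin: "finite L" "finite J"
    and w: "\<And>l i. l \<in> L \<Longrightarrow> i \<in> J \<Longrightarrow> 0 \<le> w l i"
    and row: "\<And>l. l \<in> L \<Longrightarrow> (\<Sum>i\<in>J. w l i) = 1"
    and col: "\<And>i. i \<in> J \<Longrightarrow> (\<Sum>l\<in>L. w l i) = 1"
    and x: "\<And>i. i \<in> J \<Longrightarrow> 0 \<le> x i"
  shows "powr_le p (\<Sum>l\<in>L. (\<Sum>i\<in>J. w l i * x i) powr p) (\<Sum>i\<in>J. x i powr p)"
proof -
  have "powr_le p (\<Sum>l\<in>L. (\<Sum>i\<in>J. w l i * x i) powr p) (\<Sum>l\<in>L. \<Sum>i\<in>J. w l i * x i powr p)"
    by (intro powr_le_sum jensen_powr) (auto simp: assms)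
  also have "(\<Sum>l\<in>L. \<Sum>i\<in>J. w l i * x i powr p) = (\<Sum>i\<in>J. (\<Sum>l\<in>L. w l i) * x i powr p)"
    by (subst sum.swap) (simp add: sum_distrib_right)
  finally show ?thesis by (simp add: col)
qed

text \<open>Minkowski's inequality for \<open>p \<ge> 1\<close>, reversed for \<open>p \<le> 1\<close>.  Both follow from
  Jensen's inequality by homogeneity: scaling each slice \<open>a _ k\<close> to length one exhibits the sum over
  \<open>k\<close> as a convex combination of vectors of length one.\<close>

lemma minkowski_powr:
  fixes a :: "'i \<Rightarrow> 'k \<Rightarrow> real"
  assumes p: "0 < p" and fin: "finite J" "finite K"
    and a: "\<And>i k. i \<in> J \<Longrightarrow> k \<in> K \<Longrightarrow> 0 \<le> a i k"
  shows "powr_le p ((\<Sum>i\<in>J. (\<Sum>k\<in>K. a i k) powr p) powr (1/p))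
           (\<Sum>k\<in>K. (\<Sum>i\<in>J. a i k powr p) powr (1/p))"
proof -
  define s where "s k = (\<Sum>i\<in>J. a i k powr p) powr (1/p)" for k
  define t where "t = (\<Sum>k\<in>K. s k)"
  have s_p: "s k powr p = (\<Sum>i\<in>J. a i k powr p)" for k
    unfolding s_def using p by (simp add: powr_powr sum_nonneg)
  have s0: "0 \<le> s k" for k by (simp add: s_def)
  have a_s: "a i k = 0" if "s k = 0" "i \<in> J" "k \<in> K" for i k
  proof -
    have "(\<Sum>i\<in>J. a i k powr p) = 0" using s_p[of k] that by simp
    then show ?thesis using fin that by (simp add: sum_nonneg_eq_0_iff)
  qed
  show ?thesis
  proof (cases "t = 0")
    case True
    then have "s k = 0" if "k \<in> K" for k
      using that fin s0 by (simp add: t_def sum_nonneg_eq_0_iff)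
    then have "(\<Sum>k\<in>K. a i k) = 0" if "i \<in> J" for i using a_s that by (auto intro: sum.neutral)
    then show ?thesis using True by (simp add: t_def s_def[symmetric])
  next
    case False
    then have t: "0 < t" using s0 by (simp add: t_def sum_nonneg less_le)
    \<comment> \<open>After normalising every slice by its length \<open>s k\<close>, the sum over \<open>k\<close> is a convex combination
      with weights \<open>s k / t\<close>.  A slice of length \<open>0\<close> vanishes, so \<open>x / 0 = 0\<close> is the right value for it.\<close>
    have "powr_le p (\<Sum>i\<in>J. (\<Sum>k\<in>K. s k / t * (a i k / s k)) powr p)
        (\<Sum>i\<in>J. \<Sum>k\<in>K. s k / t * (a i k / s k) powr p)"
      using a s0 t fin p
      by (intro powr_le_sum jensen_powr) (auto simp: sum_divide_distrib[symmetric] t_def[symmetric])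
    also have "(\<Sum>i\<in>J. \<Sum>k\<in>K. s k / t * (a i k / s k) powr p) =
        (\<Sum>k\<in>K. s k / t * (s k powr p / s k powr p))"
      unfolding s_p using a s0
      by (subst sum.swap, intro sum.cong refl)
        (simp add: sum_distrib_left[symmetric] sum_divide_distrib[symmetric] powr_divide s_p)
    also have "\<dots> = (\<Sum>k\<in>K. s k / t)" by (intro sum.cong) auto
    also have "\<dots> = 1" using t by (simp add: sum_divide_distrib[symmetric] t_def[symmetric])
    also have "(\<Sum>i\<in>J. (\<Sum>k\<in>K. s k / t * (a i k / s k)) powr p) =
        (\<Sum>i\<in>J. ((\<Sum>k\<in>K. a i k) / t) powr p)"
      using a_s by (intro sum.cong arg_cong2[where f="(powr)"] refl)
        (auto simp: sum_divide_distrib intro!: sum.cong)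
    also have "\<dots> = (\<Sum>i\<in>J. (\<Sum>k\<in>K. a i k) powr p) / t powr p"
      using a t by (subst sum_divide_distrib) (intro sum.cong refl, simp add: powr_divide sum_nonneg)
    finally have "powr_le p ((\<Sum>i\<in>J. (\<Sum>k\<in>K. a i k) powr p) / t powr p) 1" .
    from powr_le_mult_left[OF this, of "t powr p"]
    have "powr_le p (\<Sum>i\<in>J. (\<Sum>k\<in>K. a i k) powr p) (t powr p)" using t by simp
    from powr_le_powr[OF this, of "1/p"]
    have "powr_le p ((\<Sum>i\<in>J. (\<Sum>k\<in>K. a i k) powr p) powr (1/p)) t"
      using p t by (simp add: sum_nonneg powr_powr)
    then show ?thesis by (simp add: t_def s_def)
  qed
qed

text \<open>Jensen's inequality with equal weights; this is the origin of the power of the number of blocks.\<close>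

lemma power_mean_powr:
  fixes t :: "'k \<Rightarrow> real"
  assumes p: "0 < p" and K: "finite K" "K \<noteq> {}" and t: "\<And>k. k \<in> K \<Longrightarrow> 0 \<le> t k"
  shows "powr_le p (real (card K) powr (1/p - 1) * (\<Sum>k\<in>K. t k powr (1/p))) ((\<Sum>k\<in>K. t k) powr (1/p))"
proof -
  define r where "r = real (card K)"
  have r: "0 < r" using K by (simp add: r_def card_gt_0_iff)
  have "powr_le p ((\<Sum>k\<in>K. 1/r * t k powr (1/p)) powr p) (\<Sum>k\<in>K. 1/r * (t k powr (1/p)) powr p)"
    using K r p t by (intro jensen_powr) (auto simp: r_def)
  also have "(\<Sum>k\<in>K. 1/r * (t k powr (1/p)) powr p) = 1/r * (\<Sum>k\<in>K. t k)"
    unfolding sum_distrib_left using p t by (intro sum.cong) (auto simp: powr_powr)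
  finally have "powr_le p ((1/r * (\<Sum>k\<in>K. t k powr (1/p))) powr p) (1/r * (\<Sum>k\<in>K. t k))"
    by (simp add: sum_distrib_left)
  from powr_le_powr[OF this, of "1/p"]
  have "powr_le p (1/r * (\<Sum>k\<in>K. t k powr (1/p))) ((1/r * (\<Sum>k\<in>K. t k)) powr (1/p))"
    using p r t by (simp add: powr_powr sum_nonneg)
  from powr_le_mult_left[OF this, of "r powr (1/p)"]
  show ?thesis using r t
    by (simp add: powr_diff powr_divide sum_nonneg r_def[symmetric] field_simps)
qed

section \<open>Adjoints and unitary matrices\<close>

abbreviation adj :: "complex mat \<Rightarrow> complex mat" where "adj \<equiv> mat_adjoint"

lemma dim_adj [simp]: "dim_row (adj A) = dim_col A" "dim_col (adj A) = dim_row A"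
  by (simp_all add: mat_adjoint_def)

lemma adj_carrier [simp]: "adj A \<in> carrier_mat n m \<longleftrightarrow> A \<in> carrier_mat m n"
  by (metis carrier_matD carrier_matI dim_adj)

lemma index_adj [simp]: "i < dim_col A \<Longrightarrow> j < dim_row A \<Longrightarrow> adj A $$ (i,j) = cnj (A $$ (j,i))"
  by (simp add: mat_adjoint_def mat_of_rows_index)

lemma adj_adj [simp]: "adj (adj A) = A"
  by (intro eq_matI) auto

lemma adj_mult: "dim_col A = dim_row B \<Longrightarrow> adj (A * B) = adj B * adj A"
  by (intro eq_matI) (auto simp: scalar_prod_def intro!: sum.cong)

text \<open>Premises on dimensions, which the simplifier can decide, replace the carrier sets of the general
  associativity law; their dimension parameters would have to be guessed.\<close>

lemma mult_assoc_dim: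
  fixes A B C :: "complex mat"
  shows "dim_col A = dim_row B \<Longrightarrow> dim_col B = dim_row C \<Longrightarrow> A * B * C = A * (B * C)"
  by (rule assoc_mult_mat[of _ "dim_row A" "dim_col A" _ "dim_col B" _ "dim_col C"])
    (auto intro: carrier_matI)

lemma mult_one_dim [simp]:
  fixes A :: "complex mat"
  shows "dim_row A = n \<Longrightarrow> 1\<^sub>m n * A = A" "dim_col A = n \<Longrightarrow> A * 1\<^sub>m n = A"
  by (metis left_mult_one_mat carrier_matI, metis right_mult_one_mat carrier_matI)

lemma unitary_matD:
  assumes "unitary_mat n U"
  shows "U \<in> carrier_mat n n" "dim_row U = n" "dim_col U = n" "adj U * U = 1\<^sub>m n" "U * adj U = 1\<^sub>m n"
proof -
  show U: "U \<in> carrier_mat n n" "adj U * U = 1\<^sub>m n" using assms by (auto simp: unitary_mat_def)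
  then show "dim_row U = n" "dim_col U = n" by auto
  show "U * adj U = 1\<^sub>m n" by (rule mat_mult_left_right_inverse) (use U in auto)
qed

lemma unitary_mult:
  assumes "unitary_mat n U" "unitary_mat n V"
  shows "unitary_mat n (U * V)"
proof -
  note d = unitary_matD[OF assms(1)] unitary_matD[OF assms(2)]
  have "adj (U * V) * (U * V) = adj V * ((adj U * U) * V)"
    using d(2,3,7,8) by (simp add: adj_mult mult_assoc_dim)
  then show ?thesis using d by (simp add: unitary_mat_def)
qed

section \<open>Lengths of columns and the spectral theorem\<close>

text \<open>The squared Euclidean length of a column, equivalently a diagonal entry of the Gram matrix
  \<open>adj B * B\<close>.\<close>

definition col_sq :: "complex mat \<Rightarrow> nat \<Rightarrow> real" where
  "col_sq B j = (\<Sum>i<dim_row B. (cmod (B $$ (i,j)))\<^sup>2)"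

lemma col_sq_nonneg [simp]: "0 \<le> col_sq B j"
  by (simp add: col_sq_def sum_nonneg)

lemma gram_diagonal: "j < dim_col B \<Longrightarrow> (adj B * B) $$ (j,j) = complex_of_real (col_sq B j)"
  by (auto simp: scalar_prod_def col_sq_def lessThan_atLeast0 mult.commute
      simp flip: complex_norm_square of_real_power intro!: sum.cong)

lemma col_sq_eqI:
  assumes "j < dim_col B" "(adj B * B) $$ (j,j) = complex_of_real x"
  shows "col_sq B j = x"
  using gram_diagonal[OF assms(1)] assms(2) by (simp only: of_real_eq_iff)

lemma col_sq_cong_gram:
  assumes "adj B * B = adj C * C" "j < dim_col B"
  shows "col_sq B j = col_sq C j"
proof -
  have "dim_col C = dim_col B" using arg_cong[OF assms(1), of dim_col] by simp
  then have "complex_of_real (col_sq B j) = complex_of_real (col_sq C j)"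
    using assms by (metis gram_diagonal)
  then show ?thesis by simp
qed

text \<open>Gram-Schmidt applied to a basis that starts with \<open>v\<close> keeps \<open>v\<close> in front and yields pairwise
  orthogonal vectors; dividing them by their lengths gives the columns of \<open>W\<close>.\<close>

lemma unitary_with_first_column:
  fixes v :: "complex vec"
  assumes v: "v \<in> carrier_vec n" "v \<noteq> 0\<^sub>v n"
  obtains W c where "unitary_mat n W" "col W 0 = c \<cdot>\<^sub>v v"
proof -
  interpret cof_vec_space n "TYPE(complex)" .
  define ws where "ws = gram_schmidt n (basis_completion v)"
  note bc = basis_completion[OF v]
  note gs = gram_schmidt_result[OF bc(2,4,5) ws_def]
  have len: "length ws = n" using gs(4) bc(6) by simp
  have n: "0 < n" using v by (cases n) auto
  have hd: "ws ! 0 = v"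
  proof -
    obtain bs where bs: "basis_completion v = v # bs" using bc(6,7) n by (cases "basis_completion v") auto
    have "hd ws = v" using v by (simp add: ws_def bs)
    then show ?thesis using len n by (metis hd_conv_nth length_0_conv less_numeral_extra(3))
  qed
  have wsc: "ws ! i \<in> carrier_vec n" if "i < n" for i using gs(3) len that by auto
  define s where "s i = complex_of_real (sqrt (Re (ws ! i \<bullet>c ws ! i)))" for i
  define W where "W = mat n n (\<lambda>(a,i). ws ! i $ a / s i)"
  have W: "W \<in> carrier_mat n n" by (simp add: W_def)
  have ip: "(adj W * W) $$ (i,j) = (ws ! j \<bullet>c ws ! i) / (s i * s j)" if "i < n" "j < n" for i j
    using that wsc[OF that(1)] W
    by (simp add: scalar_prod_def W_def s_def sum_divide_distrib mult.commute)
  have norm: "s i * s i = ws ! i \<bullet>c ws ! i \<and> s i \<noteq> 0" if "i < n" for i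
  proof -
    have re: "ws ! i \<bullet>c ws ! i = complex_of_real (\<Sum>a<n. (cmod (ws ! i $ a))\<^sup>2)"
      using wsc[OF that]
      by (simp add: scalar_prod_def lessThan_atLeast0 complex_norm_square del: of_real_power)
    have "ws ! i \<bullet>c ws ! i \<noteq> 0" using corthogonalD[OF gs(2), of i i] that len by simp
    then show ?thesis unfolding s_def re
      by (simp add: sum_nonneg del: of_real_sum flip: of_real_mult)
  qed
  have "adj W * W = 1\<^sub>m n"
  proof (rule eq_matI)
    fix i j assume ij: "i < dim_row (1\<^sub>m n :: complex mat)" "j < dim_col (1\<^sub>m n :: complex mat)"
    have "ws ! j \<bullet>c ws ! i = 0" if "i \<noteq> j"
      using corthogonalD[OF gs(2), of j i] ij len that by simp
    then show "(adj W * W) $$ (i,j) = 1\<^sub>m n $$ (i,j)" using ip[of i j] norm[of i] ij by auto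
  qed (use W in auto)
  then have "unitary_mat n W" using W by (simp add: unitary_mat_def)
  moreover have "col W 0 = (1 / s 0) \<cdot>\<^sub>v v"
    using v n hd by (intro eq_vecI) (auto simp: W_def)
  ultimately show thesis by (rule that)
qed

text \<open>Spectral theorem.  A unitary change of basis puts an eigenvector first; the first column then
  vanishes below the diagonal, by Hermitian symmetry so does the first row to the right of it, and the
  induction hypothesis diagonalises the remaining block.\<close>

theorem hermitian_unitary_diagonalisation:
  assumes "A \<in> carrier_mat n n" "adj A = A"
  shows "\<exists>U f. unitary_mat n U \<and> adj U * A * U = mat_diag n f"
  using assms
proof (induction n arbitrary: A)
  case 0
  then show ?case by (intro exI[of _ "1\<^sub>m 0"] exI[of _ "\<lambda>_. 0"]) (auto simp: unitary_mat_def mat_diag_def)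
next
  case (Suc n)
  note A = Suc.prems
  obtain ev v where v: "v \<in> carrier_vec (Suc n)" "v \<noteq> 0\<^sub>v (Suc n)" "A *\<^sub>v v = ev \<cdot>\<^sub>v v"
    using spectrum_non_empty[OF A(1)] A(1)
    by (auto simp: spectrum_def eigenvalue_def eigenvector_def)
  obtain W c where W: "unitary_mat (Suc n) W" and W0: "col W 0 = c \<cdot>\<^sub>v v"
    using unitary_with_first_column[OF v(1,2)] by blast
  note Wd = unitary_matD[OF W]
  define M where "M = adj W * A * W"
  have M: "M \<in> carrier_mat (Suc n) (Suc n)" using Wd A by (simp add: M_def)
  have herm: "adj M = M" using Wd A by (simp add: M_def adj_mult mult_assoc_dim)
  have M_col: "M $$ (i, 0) = (if i = 0 then ev else 0)" if i: "i < Suc n" for i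
  proof -
    have AW: "col (A * W) 0 = ev \<cdot>\<^sub>v col W 0"
    proof -
      have "col (A * W) 0 = A *\<^sub>v col W 0" using A Wd by (intro eq_vecI) auto
      also have "\<dots> = c \<cdot>\<^sub>v (A *\<^sub>v v)" unfolding W0 using A v by (simp add: mult_mat_vec)
      finally show ?thesis using v by (simp add: W0 smult_smult_assoc mult.commute)
    qed
    have "M $$ (i,0) = row (adj W) i \<bullet> col (A * W) 0"
      using i A Wd by (simp add: M_def mult_assoc_dim)
    also have "\<dots> = ev * (row (adj W) i \<bullet> col W 0)" unfolding AW using i Wd by simp
    also have "row (adj W) i \<bullet> col W 0 = 1\<^sub>m (Suc n) $$ (i,0)"
      unfolding Wd(4)[symmetric] using i Wd(2,3) by simp
    finally show ?thesis using i by simp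
  qed
  define B where "B = mat n n (\<lambda>(i,j). M $$ (Suc i, Suc j))"
  have B: "B \<in> carrier_mat n n" by (simp add: B_def)
  have M_adj: "cnj (M $$ (j,i)) = M $$ (i,j)" if "i < Suc n" "j < Suc n" for i j
    using arg_cong[OF herm, of "\<lambda>X. X $$ (i,j)"] that M by simp
  have "adj B = B" by (intro eq_matI) (auto simp: B_def M_adj)
  with Suc.IH[OF B] obtain V f where V: "unitary_mat n V" and f: "adj V * B * V = mat_diag n f" by blast
  note Vd = unitary_matD[OF V]
  define V' where "V' = four_block_mat (1\<^sub>m 1) (0\<^sub>m 1 n) (0\<^sub>m n 1) V"
  have V': "V' \<in> carrier_mat (Suc n) (Suc n)" using Vd(2,3) by (intro carrier_matI) (simp_all add: V'_def)
  have adj_V': "adj V' = four_block_mat (1\<^sub>m 1) (0\<^sub>m 1 n) (0\<^sub>m n 1) (adj V)"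
    using Vd by (intro eq_matI) (auto simp: V'_def)
  have M_block: "M = four_block_mat (ev \<cdot>\<^sub>m 1\<^sub>m 1) (0\<^sub>m 1 n) (0\<^sub>m n 1) B"
  proof (rule eq_matI)
    fix i j
    assume "i < dim_row (four_block_mat (ev \<cdot>\<^sub>m 1\<^sub>m 1) (0\<^sub>m 1 n) (0\<^sub>m n 1) B)"
      and "j < dim_col (four_block_mat (ev \<cdot>\<^sub>m 1\<^sub>m 1) (0\<^sub>m 1 n) (0\<^sub>m n 1) B)"
    then have ij: "i < Suc n" "j < Suc n" by (simp_all add: B_def)
    show "M $$ (i,j) = four_block_mat (ev \<cdot>\<^sub>m 1\<^sub>m 1) (0\<^sub>m 1 n) (0\<^sub>m n 1) B $$ (i,j)"
      using ij M_col[of i] M_col[of j] M_adj[of i j] by (cases i; cases j) (auto simp: B_def)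
  qed (use M in \<open>auto simp: B_def\<close>)
  have "unitary_mat (Suc n) V'"
    unfolding unitary_mat_def
  proof
    show "adj V' * V' = 1\<^sub>m (Suc n)"
      unfolding adj_V' unfolding V'_def using Vd
      by (subst mult_four_block_mat[of _ 1 1 _ n _ n _ _ 1 _ n]) (auto simp: four_block_one_mat[of 1 n, simplified])
  qed (fact V')
  then have "unitary_mat (Suc n) (W * V')" by (rule unitary_mult[OF W])
  moreover have "adj (W * V') * A * (W * V') = mat_diag (Suc n) (case_nat ev f)"
  proof -
    have "adj (W * V') * A * (W * V') = adj V' * M * V'"
      using Wd A V' by (simp add: M_def adj_mult mult_assoc_dim)
    also have "\<dots> = four_block_mat (ev \<cdot>\<^sub>m 1\<^sub>m 1) (0\<^sub>m 1 n) (0\<^sub>m n 1) (adj V * B * V)"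
      unfolding adj_V' M_block unfolding V'_def using Vd B
      by (subst mult_four_block_mat[of _ 1 1 _ n _ n _ _ 1 _ n], auto)
        (subst mult_four_block_mat[of _ 1 1 _ n _ n _ _ 1 _ n], auto)
    also have "\<dots> = mat_diag (Suc n) (case_nat ev f)"
      unfolding f by (intro eq_matI) (auto simp: mat_diag_def split: nat.splits)
    finally show ?thesis .
  qed
  ultimately show ?case by blast
qed

section \<open>Traces of powers of Gram matrices\<close>

text \<open>This is \<open>Tr |A|^(2p)\<close>, the power \<open>q = 2p\<close> of the Schatten \<open>q\<close>-norm.  Working with the Gram
  matrix avoids the square root in \<open>|A|\<close> and places the change of behaviour at \<open>p = 1\<close>.\<close>

definition gram_trace :: "real \<Rightarrow> complex mat \<Rightarrow> real" where
  "gram_trace p A = Re (mat_trace (psd_powr (adj A * A) p))"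

text \<open>The eigenvalues that the spectral theorem gives for a Gram matrix are squared lengths of the columns of
  \<open>A * U\<close>, hence real and nonnegative.\<close>

lemma psd_diagonalisation_gram_exists:
  "\<exists>U e. psd_diagonalisation (adj A * A) (dim_col A) U e"
proof -
  define n where "n = dim_col A"
  have "adj (adj A * A) = adj A * A" by (simp add: adj_mult)
  moreover have "adj A * A \<in> carrier_mat n n" by (rule carrier_matI) (auto simp: n_def)
  ultimately obtain U f where U: "unitary_mat n U" and f: "adj U * (adj A * A) * U = mat_diag n f"
    using hermitian_unitary_diagonalisation by blast
  note Ud = unitary_matD[OF U]
  have gram: "adj (A * U) * (A * U) = mat_diag n f"
    using f Ud by (simp add: adj_mult mult_assoc_dim n_def)
  have fi: "f i = complex_of_real (col_sq (A * U) i)" if "i < n" for i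
    using gram_diagonal[of i "A * U"] that Ud unfolding gram by (simp add: mat_diag_def)
  have "mat_diag n (\<lambda>i. complex_of_real (col_sq (A * U) i)) = mat_diag n f"
    by (intro eq_matI) (auto simp: mat_diag_def fi)
  moreover have "U * (adj U * (adj A * A) * U) * adj U = (U * adj U) * (adj A * A) * (U * adj U)"
    using Ud(1-3) by (simp add: mult_assoc_dim n_def)
  ultimately have "psd_diagonalisation (adj A * A) n U (\<lambda>i. col_sq (A * U) i)"
    using U Ud f by (simp add: psd_diagonalisation_def n_def)
  then show ?thesis unfolding n_def by blast
qed

lemma psd_diagonalisation_gramD:
  assumes "psd_diagonalisation (adj A * A) n U e"
  shows "n = dim_col A" "unitary_mat n U" "\<And>i. i < n \<Longrightarrow> 0 \<le> e i"
    and "adj (A * U) * (A * U) = mat_diag n (\<lambda>i. complex_of_real (e i))"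
proof -
  let ?D = "mat_diag n (\<lambda>i. complex_of_real (e i))"
  have U: "unitary_mat n U" and eq: "adj A * A = U * ?D * adj U"
    using assms by (auto simp: psd_diagonalisation_def)
  show "unitary_mat n U" "\<And>i. i < n \<Longrightarrow> 0 \<le> e i" using assms by (auto simp: psd_diagonalisation_def)
  note Ud = unitary_matD[OF U]
  show n: "n = dim_col A" using arg_cong[OF eq, of dim_row] Ud by simp
  have D: "dim_row ?D = n" "dim_col ?D = n" by (auto simp: mat_diag_def)
  have "adj (A * U) * (A * U) = adj U * (adj A * A) * U"
    using Ud(1-3) n by (simp add: adj_mult mult_assoc_dim)
  also have "\<dots> = (adj U * U) * ?D * (adj U * U)"
    unfolding eq using Ud(1-3) D by (simp add: mult_assoc_dim)
  finally show "adj (A * U) * (A * U) = ?D" using Ud D by simp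
qed

lemma mat_trace_unitary_conjugate:
  assumes "unitary_mat n U"
  shows "mat_trace (U * mat_diag n f * adj U) = (\<Sum>i<n. f i)"
proof -
  note Ud = unitary_matD[OF assms]
  have "mat_trace (U * mat_diag n f * adj U) = (\<Sum>i<n. \<Sum>j<n. f j * (cnj (U $$ (i,j)) * U $$ (i,j)))"
    unfolding mat_trace_def mat_diag_mult_right[OF Ud(1)] using Ud(2,3)
    by (auto simp: scalar_prod_def lessThan_atLeast0 intro!: sum.cong)
  also have "\<dots> = (\<Sum>j<n. f j * (adj U * U) $$ (j,j))"
    using Ud(2,3)
    by (subst sum.swap) (auto simp: scalar_prod_def lessThan_atLeast0 sum_distrib_left intro!: sum.cong)
  finally show ?thesis using Ud by simp
qed

lemma gram_trace_eq:
  assumes "psd_diagonalisation (adj A * A) n U e"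
  shows "gram_trace p A = (\<Sum>i<n. e i powr p)"
  using psd_powr_eqI[OF assms] mat_trace_unitary_conjugate[OF psd_diagonalisation_gramD(2)[OF assms]]
  by (simp add: gram_trace_def)

lemma gram_trace_nonneg [simp]: "0 \<le> gram_trace p A"
  using psd_diagonalisation_gram_exists[of A] by (auto simp: gram_trace_eq sum_nonneg)

lemma schatten_norm_sq:
  assumes "0 < q"
  shows "(schatten_norm q A)\<^sup>2 = gram_trace (q/2) A powr (2/q)"
proof -
  obtain n U e where *: "psd_diagonalisation (adj A * A) n U e"
    using psd_diagonalisation_gram_exists by blast
  note U = psd_diagonalisation_gramD(2)[OF *]
  have abs: "psd_diagonalisation (mat_abs A) n U (\<lambda>i. e i powr (1/2))"
    unfolding mat_abs_def psd_powr_eqI[OF *] using U by (simp add: psd_diagonalisation_def)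
  have "schatten_norm q A = gram_trace (q/2) A powr (1/q)"
    unfolding schatten_norm_def psd_powr_eqI[OF abs] mat_trace_unitary_conjugate[OF U] gram_trace_eq[OF *]
    by (simp add: powr_powr)
  then show ?thesis
    by (simp add: power2_eq_square flip: powr_add)
qed

text \<open>Take unitary \<open>U\<close> and \<open>W\<close> that diagonalise \<open>adj A * A\<close> and \<open>A * adj A\<close> with eigenvalues \<open>e\<close> and \<open>f\<close>,
  and put \<open>C = adj W * A * U\<close>.  Both Gram matrices of \<open>C\<close> are diagonal, so \<open>C * (adj C * C) = (C * adj C) * C\<close>
  says that an entry of \<open>C\<close> vanishes unless its two eigenvalues agree.  The squared entries of \<open>C\<close> have
  column sums \<open>e\<close> and row sums \<open>f\<close>, so weighting them by the power \<open>p - 1\<close> of the common eigenvalue and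
  summing in both orders gives the two traces.\<close>

lemma gram_trace_adj:
  assumes "0 < p" shows "gram_trace p (adj A) = gram_trace p A"
proof -
  obtain m U e where U: "psd_diagonalisation (adj A * A) m U e"
    using psd_diagonalisation_gram_exists by blast
  obtain n W f where W: "psd_diagonalisation (adj (adj A) * adj A) n W f"
    using psd_diagonalisation_gram_exists by blast
  note Ud = psd_diagonalisation_gramD[OF U] and Wd = psd_diagonalisation_gramD[OF W]
  note Um = unitary_matD[OF Ud(2)] and Wm = unitary_matD[OF Wd(2)]
  have dims: "dim_col A = m" "dim_row A = n" using Ud(1) Wd(1) by simp_all
  define C where "C = adj W * A * U"
  have C: "dim_row C = n" "dim_col C = m" using Um Wm by (simp_all add: C_def)
  have CC: "adj C * C = mat_diag m (\<lambda>i. complex_of_real (e i))"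
  proof -
    have "adj C * C = adj (A * U) * ((W * adj W) * (A * U))"
      using Um(1-3) Wm(1-3) dims by (simp add: C_def adj_mult mult_assoc_dim)
    then show ?thesis using Ud(4) Wm dims by simp
  qed
  have CC': "C * adj C = mat_diag n (\<lambda>i. complex_of_real (f i))"
  proof -
    have "C * adj C = adj (adj A * W) * ((U * adj U) * (adj A * W))"
      using Um(1-3) Wm(1-3) dims by (simp add: C_def adj_mult mult_assoc_dim)
    then show ?thesis using Wd(4) Um dims by simp
  qed
  have "C * (adj C * C) = (C * adj C) * C" by (simp add: mult_assoc_dim)
  then have "C * mat_diag m (\<lambda>i. complex_of_real (e i)) = mat_diag n (\<lambda>i. complex_of_real (f i)) * C"
    by (simp only: CC CC')
  then have comm: "C $$ (i,j) * complex_of_real (e j) = complex_of_real (f i) * C $$ (i,j)"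
    if "i < n" "j < m" for i j
    using that C arg_cong[of _ _ "\<lambda>M. M $$ (i,j)"]
    by (metis (no_types, lifting) carrier_matI case_prod_conv index_mat(1) mat_diag_mult_left mat_diag_mult_right)
  define c where "c i j = (cmod (C $$ (i,j)))\<^sup>2" for i j
  have same: "e j powr s * c i j = f i powr s * c i j" if "i < n" "j < m" for i j s
  proof (cases "C $$ (i,j) = 0")
    case False
    then have "complex_of_real (e j) = complex_of_real (f i)" using comm[OF that] by (simp add: mult.commute)
    then show ?thesis by simp
  qed (simp add: c_def)
  have col: "(\<Sum>i<n. c i j) = e j" if "j < m" for j
    using col_sq_eqI[of j C "e j"] that C unfolding CC by (simp add: mat_diag_def col_sq_def c_def)
  have row: "(\<Sum>j<m. c i j) = f i" if "i < n" for i
    using col_sq_eqI[of i "adj C" "f i"] that C unfolding adj_adj CC'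
    by (simp add: mat_diag_def col_sq_def c_def)
  \<comment> \<open>valid at \<open>x = 0\<close> also for \<open>p < 1\<close>, as \<open>0 powr p = 0\<close>\<close>
  have split: "x powr p = x powr (p - 1) * x" if "0 \<le> x" for x :: real
    using that by (cases "x = 0") (simp_all add: powr_diff)
  have "gram_trace p A = (\<Sum>j<m. e j powr (p - 1) * (\<Sum>i<n. c i j))"
    unfolding gram_trace_eq[OF U] using Ud(3) by (intro sum.cong refl) (simp add: col flip: split)
  also have "\<dots> = (\<Sum>j<m. \<Sum>i<n. f i powr (p - 1) * c i j)"
    unfolding sum_distrib_left by (intro sum.cong refl same) auto
  also have "\<dots> = (\<Sum>i<n. f i powr (p - 1) * (\<Sum>j<m. c i j))"
    by (subst sum.swap) (simp add: sum_distrib_left)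
  also have "\<dots> = gram_trace p (adj A)"
    unfolding gram_trace_eq[OF W] using Wd(3) by (intro sum.cong refl) (simp add: row flip: split)
  finally show ?thesis by simp
qed

section \<open>Orthogonal splittings\<close>

text \<open>A decomposition of the space of dimension \<open>d\<close> into mutually orthogonal subspaces: \<open>S k\<close> maps the
  \<open>k\<close>-th subspace isometrically onto a coordinate space and kills its complement.  The last condition is
  the resolution of the identity \<open>\<Sum>k. adj (S k) * S k = 1\<close>, phrased as Pythagoras' theorem for columns
  so that no sums of matrices occur.  Restriction to the members of a partition of the coordinates is
  the case that matters for blocks.\<close>

definition isometric_splitting :: "nat \<Rightarrow> 'k set \<Rightarrow> ('k \<Rightarrow> complex mat) \<Rightarrow> bool" where
  "isometric_splitting d K S \<longleftrightarrow> finite K \<and>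
     (\<forall>k\<in>K. dim_col (S k) = d \<and> S k * adj (S k) = 1\<^sub>m (dim_row (S k))) \<and>
     (\<forall>X. dim_row X = d \<longrightarrow> (\<forall>j<dim_col X. (\<Sum>k\<in>K. col_sq (S k * X) j) = col_sq X j))"

lemma col_sq_mult_diagonal_gram:
  assumes gram: "adj B * B = mat_diag n (\<lambda>i. complex_of_real (e i))"
    and W: "dim_row W = n" "l < dim_col W"
  shows "col_sq (B * W) l = (\<Sum>i<n. (cmod (W $$ (i,l)))\<^sup>2 * e i)"
proof -
  have B: "dim_col B = n" using arg_cong[OF gram, of dim_col] by (simp add: mat_diag_def)
  have "complex_of_real (col_sq (B * W) l) = (adj W * ((adj B * B) * W)) $$ (l,l)"
    using gram_diagonal[of l "B * W"] W B by (simp add: adj_mult mult_assoc_dim)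
  also have "\<dots> = (\<Sum>i<n. cnj (W $$ (i,l)) * (complex_of_real (e i) * W $$ (i,l)))"
    unfolding gram using W
    by (simp add: mat_diag_mult_left[OF carrier_matI[OF W(1) refl]] scalar_prod_def lessThan_atLeast0)
  also have "\<dots> = complex_of_real (\<Sum>i<n. (cmod (W $$ (i,l)))\<^sup>2 * e i)"
    by (auto simp: complex_norm_square ac_simps simp del: of_real_power intro!: sum.cong)
  finally show ?thesis by (simp only: of_real_eq_iff)
qed

text \<open>The columns of all the \<open>adj (S k)\<close> together form an orthonormal basis.  The squared lengths of their
  images under \<open>A\<close> are the diagonal entries of the Gram matrix in that basis, hence averages of its
  eigenvalues; the weights are squared moduli of the entries of a unitary matrix and therefore doubly
  stochastic.\<close>

lemma compression_powr_le_gram_trace: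
  assumes p: "0 < p" and S: "isometric_splitting (dim_col A) K S"
  shows "powr_le p (\<Sum>k\<in>K. \<Sum>l<dim_row (S k). col_sq (A * adj (S k)) l powr p) (gram_trace p A)"
proof -
  obtain n U e where U: "psd_diagonalisation (adj A * A) n U e"
    using psd_diagonalisation_gram_exists by blast
  note Ud = psd_diagonalisation_gramD[OF U] and Um = unitary_matD[OF psd_diagonalisation_gramD(2)[OF U]]
  have fin: "finite K" and Sk: "\<And>k. k \<in> K \<Longrightarrow> dim_col (S k) = n"
      "\<And>k. k \<in> K \<Longrightarrow> S k * adj (S k) = 1\<^sub>m (dim_row (S k))"
    and pars: "\<And>X j. dim_row X = n \<Longrightarrow> j < dim_col X \<Longrightarrow> (\<Sum>k\<in>K. col_sq (S k * X) j) = col_sq X j"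
    using S Ud(1) by (auto simp: isometric_splitting_def)
  define w where "w = (\<lambda>(k,l) i. (cmod ((S k * U) $$ (l,i)))\<^sup>2)"
  define L where "L = Sigma K (\<lambda>k. {..<dim_row (S k)})"
  have expand: "col_sq (A * adj (S k)) l = (\<Sum>i<n. w (k,l) i * e i)"
    if kl: "k \<in> K" "l < dim_row (S k)" for k l
  proof -
    have "A * adj (S k) = (A * U) * adj (S k * U)"
    proof -
      have "(A * U) * adj (S k * U) = A * ((U * adj U) * adj (S k))"
        using Um(1-3) Ud(1) Sk(1)[OF kl(1)] by (simp add: adj_mult mult_assoc_dim)
      then show ?thesis using Um Sk(1)[OF kl(1)] by simp
    qed
    then have "col_sq (A * adj (S k)) l = (\<Sum>i<n. (cmod (adj (S k * U) $$ (i,l)))\<^sup>2 * e i)"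
      using col_sq_mult_diagonal_gram[OF Ud(4), of "adj (S k * U)" l] kl Um by simp
    then show ?thesis using kl Um by (simp add: w_def)
  qed
  have row: "(\<Sum>i<n. w (k,l) i) = 1" if kl: "k \<in> K" "l < dim_row (S k)" for k l
  proof -
    have "adj (adj (S k * U)) * adj (S k * U) = S k * ((U * adj U) * adj (S k))"
      using Um(1-3) Sk(1)[OF kl(1)] by (simp add: adj_mult mult_assoc_dim)
    also have "\<dots> = 1\<^sub>m (dim_row (S k))" using Um Sk kl by simp
    finally have "col_sq (adj (S k * U)) l = 1" using kl by (intro col_sq_eqI) simp_all
    then show ?thesis using kl Um by (simp add: w_def col_sq_def)
  qed
  have col: "(\<Sum>kl\<in>L. w kl i) = 1" if "i < n" for i
  proof -
    have "(\<Sum>kl\<in>L. w kl i) = (\<Sum>k\<in>K. col_sq (S k * U) i)"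
      using fin by (simp add: L_def sum.Sigma w_def col_sq_def split_beta)
    also have "\<dots> = col_sq U i" using pars Um that by simp
    also have "\<dots> = 1" using Um that by (intro col_sq_eqI) simp_all
    finally show ?thesis .
  qed
  have "powr_le p (\<Sum>kl\<in>L. (\<Sum>i<n. w kl i * e i) powr p) (\<Sum>i<n. e i powr p)"
    using p fin row col Ud(3) by (intro powr_le_doubly_stochastic) (auto simp: L_def w_def)
  also have "(\<Sum>kl\<in>L. (\<Sum>i<n. w kl i * e i) powr p) =
      (\<Sum>k\<in>K. \<Sum>l<dim_row (S k). col_sq (A * adj (S k)) l powr p)"
    using fin by (simp add: L_def sum.Sigma expand split_beta)
  finally show ?thesis by (simp add: gram_trace_eq[OF U])
qed

text \<open>The bound on the diagonal is used in a basis adapted to the splitting: within each subspace, the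
  eigenvectors of the Gram matrix of \<open>A * adj (S k)\<close>.  In this basis the diagonal entries are exactly the
  eigenvalues of these Gram matrices.\<close>

lemma gram_trace_superadditive_columns:
  assumes p: "0 < p" and S: "isometric_splitting (dim_col A) K S"
  shows "powr_le p (\<Sum>k\<in>K. gram_trace p (A * adj (S k))) (gram_trace p A)"
proof -
  define n where "n k = dim_row (S k)" for k
  have Sk: "\<And>k. k \<in> K \<Longrightarrow> dim_col (S k) = dim_col A"
      "\<And>k. k \<in> K \<Longrightarrow> S k * adj (S k) = 1\<^sub>m (n k)"
    and pars: "\<And>X j. dim_row X = dim_col A \<Longrightarrow> j < dim_col X \<Longrightarrow> (\<Sum>k\<in>K. col_sq (S k * X) j) = col_sq X j"
    using S by (auto simp: isometric_splitting_def n_def)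
  have "\<exists>V e. psd_diagonalisation (adj (A * adj (S k)) * (A * adj (S k))) (n k) V e" for k
    using psd_diagonalisation_gram_exists[of "A * adj (S k)"] by (simp add: n_def)
  then obtain V e where V: "\<And>k. psd_diagonalisation (adj (A * adj (S k)) * (A * adj (S k))) (n k) (V k) (e k)"
    by metis
  note Vd = psd_diagonalisation_gramD[OF V]
  note Vm = unitary_matD[OF Vd(2)]
  define S' where "S' k = adj (V k) * S k" for k
  have S'_dim: "dim_row (S' k) = n k" "dim_col (S' k) = dim_col (S k)" for k
    using Vm by (simp_all add: S'_def)
  have "isometric_splitting (dim_col A) K S'"
    unfolding isometric_splitting_def
  proof (intro conjI ballI allI impI)
    fix k assume k: "k \<in> K"
    show "dim_col (S' k) = dim_col A" using Sk[OF k] S'_dim by simp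
    have "S' k * adj (S' k) = adj (V k) * ((S k * adj (S k)) * V k)"
      using Sk(1)[OF k] Vm(1-3) by (simp add: S'_def adj_mult mult_assoc_dim n_def)
    then show "S' k * adj (S' k) = 1\<^sub>m (dim_row (S' k))" using Sk[OF k] Vm S'_dim by simp
  next
    fix X :: "complex mat" and j assume X: "dim_row X = dim_col A" "j < dim_col X"
    have "col_sq (S' k * X) j = col_sq (S k * X) j" if k: "k \<in> K" for k
    proof (rule col_sq_cong_gram)
      have "adj (S' k * X) * (S' k * X) = adj (S k * X) * ((V k * adj (V k)) * (S k * X))"
        using Sk(1)[OF k] Vm(1-3) X by (simp add: S'_def adj_mult mult_assoc_dim n_def)
      then show "adj (S' k * X) * (S' k * X) = adj (S k * X) * (S k * X)"
        using Vm by (simp add: n_def)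
    qed (use X in simp)
    then show "(\<Sum>k\<in>K. col_sq (S' k * X) j) = col_sq X j" using pars[OF X] by simp
  qed (use S in \<open>simp add: isometric_splitting_def\<close>)
  from compression_powr_le_gram_trace[OF p this]
  have "powr_le p (\<Sum>k\<in>K. \<Sum>l<n k. col_sq (A * adj (S' k)) l powr p) (gram_trace p A)"
    by (simp add: S'_dim)
  moreover have "(\<Sum>l<n k. col_sq (A * adj (S' k)) l powr p) = gram_trace p (A * adj (S k))"
    if k: "k \<in> K" for k
  proof -
    have "A * adj (S' k) = A * adj (S k) * V k"
      using Sk(1)[OF k] Vm(1-3) by (simp add: S'_def adj_mult mult_assoc_dim n_def)
    then have "col_sq (A * adj (S' k)) l = e k l" if "l < n k" for l
      using col_sq_eqI[of l "A * adj (S k) * V k" "e k l"] Vm that unfolding Vd(4)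
      by (simp add: mat_diag_def)
    then show ?thesis by (simp add: gram_trace_eq[OF V])
  qed
  ultimately show ?thesis by simp
qed

text \<open>In an eigenbasis \<open>U\<close> of the Gram matrix of \<open>A\<close>, each eigenvalue is the sum over \<open>k\<close> of the squared
  lengths of the pieces \<open>S k * A * U\<close>.  The scalar Minkowski inequality separates the pieces, and the bound
  on the diagonal, for the single basis \<open>U\<close>, compares each of them with its own trace.\<close>

lemma gram_trace_minkowski_rows:
  assumes p: "0 < p" and S: "isometric_splitting (dim_row A) K S"
  shows "powr_le p (gram_trace p A powr (1/p)) (\<Sum>k\<in>K. gram_trace p (S k * A) powr (1/p))"
proof -
  obtain n U e where U: "psd_diagonalisation (adj A * A) n U e"
    using psd_diagonalisation_gram_exists by blast
  note Ud = psd_diagonalisation_gramD[OF U] and Um = unitary_matD[OF psd_diagonalisation_gramD(2)[OF U]]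
  have fin: "finite K" and Sk: "\<And>k. k \<in> K \<Longrightarrow> dim_col (S k) = dim_row A"
    using S by (auto simp: isometric_splitting_def)
  define a where "a i k = col_sq (S k * A * U) i" for i k
  have e: "e i = (\<Sum>k\<in>K. a i k)" if "i < n" for i
  proof -
    have "e i = col_sq (A * U) i"
      using col_sq_eqI[of i "A * U" "e i"] Um that unfolding Ud(4) by (simp add: mat_diag_def)
    also have "\<dots> = (\<Sum>k\<in>K. col_sq (S k * (A * U)) i)"
      using S Um that by (simp add: isometric_splitting_def)
    finally show ?thesis
      using Sk Um(2) Ud(1) by (simp add: a_def mult_assoc_dim)
  qed
  have basis: "isometric_splitting n {()} (\<lambda>_. adj U)"
  proof -
    have "col_sq (adj U * X) j = col_sq X j" if "dim_row X = n" "j < dim_col X" for X j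
    proof (rule col_sq_cong_gram)
      have "adj (adj U * X) * (adj U * X) = adj X * ((U * adj U) * X)"
        using Um(1-3) that by (simp add: adj_mult mult_assoc_dim)
      then show "adj (adj U * X) * (adj U * X) = adj X * X" using Um that by simp
    qed (use that in simp)
    then show ?thesis using Um by (simp add: isometric_splitting_def)
  qed
  have slice: "powr_le p (\<Sum>i<n. a i k powr p) (gram_trace p (S k * A))" for k
    using compression_powr_le_gram_trace[OF p, of "S k * A" "{()}" "\<lambda>_. adj U"] basis Ud(1) Um
    by (simp add: a_def)
  have "gram_trace p A powr (1/p) = (\<Sum>i<n. (\<Sum>k\<in>K. a i k) powr p) powr (1/p)"
    by (simp add: gram_trace_eq[OF U] e)
  also have "powr_le p \<dots> (\<Sum>k\<in>K. (\<Sum>i<n. a i k powr p) powr (1/p))"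
    using p fin by (intro minkowski_powr) (auto simp: a_def)
  also have "powr_le p \<dots> (\<Sum>k\<in>K. gram_trace p (S k * A) powr (1/p))"
    using slice p by (intro powr_le_sum powr_le_powr) (auto intro: sum_nonneg)
  finally show ?thesis .
qed

lemma gram_trace_superadditive_rows:
  assumes p: "0 < p" and S: "isometric_splitting (dim_row A) K S"
  shows "powr_le p (\<Sum>k\<in>K. gram_trace p (S k * A)) (gram_trace p A)"
proof -
  have "gram_trace p (adj A * adj (S k)) = gram_trace p (S k * A)" if "k \<in> K" for k
    using that S gram_trace_adj[OF p, of "S k * A"] by (auto simp: isometric_splitting_def adj_mult)
  then show ?thesis
    using gram_trace_superadditive_columns[OF p, of "adj A" K S] S gram_trace_adj[OF p, of A] by simp
qed

lemma gram_trace_minkowski_columns: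
  assumes p: "0 < p" and S: "isometric_splitting (dim_col A) K S"
  shows "powr_le p (gram_trace p A powr (1/p)) (\<Sum>k\<in>K. gram_trace p (A * adj (S k)) powr (1/p))"
proof -
  have "gram_trace p (S k * adj A) = gram_trace p (A * adj (S k))" if "k \<in> K" for k
    using that S gram_trace_adj[OF p, of "A * adj (S k)"] by (auto simp: isometric_splitting_def adj_mult)
  then show ?thesis
    using gram_trace_minkowski_rows[OF p, of "adj A" K S] S gram_trace_adj[OF p, of A] by simp
qed

lemma gram_trace_empty:
  assumes "0 < p" "dim_row A = 0 \<or> dim_col A = 0"
  shows "gram_trace p A = 0"
proof -
  have "gram_trace p B = 0" if "dim_col B = 0" for B
  proof -
    obtain U e where "psd_diagonalisation (adj B * B) (dim_col B) U e"
      using psd_diagonalisation_gram_exists by blast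
    from gram_trace_eq[OF this] show ?thesis using that by simp
  qed
  from this[of A] this[of "adj A"] show ?thesis using assms gram_trace_adj[of p A] by auto
qed

section \<open>Submatrices as products with selection matrices\<close>

text \<open>Multiplication by this matrix from the left keeps the rows with index in \<open>I\<close>, so that cutting out a
  submatrix becomes a matrix product.\<close>

definition row_selection :: "nat \<Rightarrow> nat set \<Rightarrow> complex mat" where
  "row_selection d I = submatrix (1\<^sub>m d) I UNIV"

lemma bij_betw_pick: "finite I \<Longrightarrow> bij_betw (pick I) {..<card I} I"
proof -
  assume fin: "finite I"
  have inj: "inj_on (pick I) {..<card I}"
    by (rule linorder_inj_onI) (auto dest: pick_mono_le[of _ I])
  have "pick I ` {..<card I} = I"
    using fin by (intro card_subset_eq) (auto simp: pick_in_set_le card_image[OF inj])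
  with inj show ?thesis by (simp add: bij_betw_def)
qed

lemma Collect_bounded_subset: "I \<subseteq> {..<d} \<Longrightarrow> {i. i < d \<and> i \<in> I} = I"
  by auto

lemma pick_less: "I \<subseteq> {..<d} \<Longrightarrow> i < card I \<Longrightarrow> pick I i < d"
  using pick_in_set_le by blast

lemma row_selection_simps:
  assumes "I \<subseteq> {..<d}"
  shows "dim_row (row_selection d I) = card I" "dim_col (row_selection d I) = d"
    and "i < card I \<Longrightarrow> a < d \<Longrightarrow> row_selection d I $$ (i,a) = (if a = pick I i then 1 else 0)"
  using assms by (auto simp: row_selection_def submatrix_def Collect_bounded_subset pick_UNIV pick_less)

lemma row_selection_mult_index:
  assumes "I \<subseteq> {..<d}" "dim_row X = d" "i < card I" "j < dim_col X"
  shows "(row_selection d I * X) $$ (i,j) = X $$ (pick I i, j)"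
  using assms row_selection_simps[OF assms(1)] pick_less[OF assms(1)]
  by (simp add: scalar_prod_def if_distrib[of "\<lambda>x. x * _"] sum.delta cong: if_cong)

lemma mult_adj_row_selection_index:
  assumes "J \<subseteq> {..<d}" "dim_col X = d" "i < dim_row X" "j < card J"
  shows "(X * adj (row_selection d J)) $$ (i,j) = X $$ (i, pick J j)"
proof -
  have "X * adj (row_selection d J) = adj (row_selection d J * adj X)"
    using assms by (simp add: adj_mult row_selection_simps)
  then show ?thesis
    using assms row_selection_mult_index[of J d "adj X" j i] pick_less[of J d j]
    by (simp add: row_selection_simps del: index_mult_mat(1))
qed

lemma submatrix_conv_row_selection:
  assumes "I \<subseteq> {..<dim_row A}" "J \<subseteq> {..<dim_col A}"
  shows "submatrix A I J = row_selection (dim_row A) I * A * adj (row_selection (dim_col A) J)"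
  using assms
  by (intro eq_matI)
    (simp_all add: submatrix_def Collect_bounded_subset row_selection_simps pick_less
      mult_adj_row_selection_index row_selection_mult_index del: index_mult_mat(1))

lemma submatrix_adj:
  assumes "I \<subseteq> {..<dim_row A}" "J \<subseteq> {..<dim_col A}"
  shows "submatrix (adj A) J I = adj (submatrix A I J)"
  using assms
  by (intro eq_matI) (auto simp: submatrix_def Collect_bounded_subset pick_less)

lemma isometric_splitting_row_selection:
  assumes K: "finite K" "disjoint_family_on I K" "(\<Union>k\<in>K. I k) = {..<d}"
  shows "isometric_splitting d K (\<lambda>k. row_selection d (I k))"
  unfolding isometric_splitting_def
proof (intro conjI ballI allI impI)
  fix k assume "k \<in> K"
  then have k: "I k \<subseteq> {..<d}" "finite (I k)" using K by (auto intro: finite_subset[of _ "{..<d}"])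
  note s = row_selection_simps[OF k(1)]
  show "dim_col (row_selection d (I k)) = d" by (fact s)
  have "pick (I k) i = pick (I k) j \<longleftrightarrow> i = j" if "i < card (I k)" "j < card (I k)" for i j
    using bij_betw_pick[OF k(2)] that by (auto simp: bij_betw_def inj_on_def)
  then show "row_selection d (I k) * adj (row_selection d (I k)) = 1\<^sub>m (dim_row (row_selection d (I k)))"
    using k(1) by (intro eq_matI)
      (auto simp: s row_selection_mult_index pick_less simp del: index_mult_mat(1))
next
  fix X :: "complex mat" and j assume X: "dim_row X = d" "j < dim_col X"
  have "col_sq (row_selection d (I k) * X) j = (\<Sum>a\<in>I k. (cmod (X $$ (a,j)))\<^sup>2)" if "k \<in> K" for k
  proof -
    have k: "I k \<subseteq> {..<d}" "finite (I k)" using K that by (auto intro: finite_subset[of _ "{..<d}"])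
    have "col_sq (row_selection d (I k) * X) j = (\<Sum>i<card (I k). (cmod (X $$ (pick (I k) i,j)))\<^sup>2)"
      using X k(1) by (auto simp: col_sq_def row_selection_simps row_selection_mult_index
          simp del: index_mult_mat(1) intro!: sum.cong)
    also have "\<dots> = (\<Sum>a\<in>I k. (cmod (X $$ (a,j)))\<^sup>2)"
      by (rule sum.reindex_bij_betw[OF bij_betw_pick[OF k(2)]])
    finally show ?thesis .
  qed
  then have "(\<Sum>k\<in>K. col_sq (row_selection d (I k) * X) j) = (\<Sum>k\<in>K. \<Sum>a\<in>I k. (cmod (X $$ (a,j)))\<^sup>2)"
    by simp
  also have "\<dots> = (\<Sum>a\<in>(\<Union>k\<in>K. I k). (cmod (X $$ (a,j)))\<^sup>2)"
    using K by (intro sum.UNION_disjoint_family[symmetric])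
      (auto intro: finite_subset[of _ "{..<d}"])
  finally show "(\<Sum>k\<in>K. col_sq (row_selection d (I k) * X) j) = col_sq X j"
    using K X by (simp add: col_sq_def)
qed (fact K)

section \<open>Compatible block partitions\<close>

lemma block_partition_subset:
  assumes "block_partition d d' r R C" "k \<in> {1..r}"
  shows "R k \<subseteq> {..<d}" "C k \<subseteq> {..<d'}" "R k \<noteq> {}" "C k \<noteq> {}"
proof -
  show ne: "R k \<noteq> {}" "C k \<noteq> {}" using assms unfolding block_partition_def by fastforce+
  have "R k \<times> C k \<subseteq> {..<d} \<times> {..<d'}" using assms unfolding block_partition_def by blast
  then show "R k \<subseteq> {..<d}" "C k \<subseteq> {..<d'}" using ne by auto
qed

lemma block_partition_swap:
  assumes "block_partition d d' r R C"
  shows "block_partition d' d r C R"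
proof -
  have "(\<Union>k\<in>{1..r}. C k \<times> R k) = prod.swap ` (\<Union>k\<in>{1..r}. R k \<times> C k)"
    by (simp add: image_UN product_swap)
  also have "\<dots> = {..<d'} \<times> {..<d}" using assms by (auto simp: block_partition_def)
  finally have "(\<Union>k\<in>{1..r}. C k \<times> R k) = {..<d'} \<times> {..<d}" .
  moreover have "disjoint_family_on (\<lambda>k. C k \<times> R k) {1..r}"
    using assms unfolding block_partition_def disjoint_family_on_def Times_Int_Times Times_empty
    by blast
  ultimately show ?thesis using assms unfolding block_partition_def by blast
qed

text \<open>The distinct column sets cut the matrix into vertical strips, and the blocks within one strip share
  their columns and partition the rows.  Each of the two inequalities is applied once to the columns and
  once, inside every strip, to the rows.\<close>

lemma gram_trace_column_compatible:
  assumes A: "A \<in> carrier_mat d d'" and bp: "block_partition d d' r R C"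
    and cc: "column_compatible r C" and r: "0 < r" and p: "0 < p"
  shows "powr_le p (\<Sum>k=1..r. gram_trace p (submatrix A (R k) (C k))) (gram_trace p A)"
    and "powr_le p (gram_trace p A powr (1/p)) (\<Sum>k=1..r. gram_trace p (submatrix A (R k) (C k)) powr (1/p))"
proof -
  define CS where "CS = C ` {1..r}"
  define B where "B J = A * adj (row_selection d' J)" for J
  define K where "K J = {k \<in> {1..r}. C k = J}" for J
  have dims: "dim_row A = d" "dim_col A = d'" using A by auto
  note sub = block_partition_subset[OF bp]
  have cover: "\<exists>k\<in>{1..r}. a \<in> R k \<and> b \<in> C k" if "a < d" "b < d'" for a b
  proof -
    have "(a,b) \<in> (\<Union>k\<in>{1..r}. R k \<times> C k)" using bp that by (simp add: block_partition_def)
    then show ?thesis by auto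
  qed
  have disj: "k = l" if "k \<in> {1..r}" "l \<in> {1..r}" "a \<in> R k" "a \<in> R l" "b \<in> C k" "b \<in> C l" for k l a b
    using bp that unfolding block_partition_def disjoint_family_on_def by blast
  obtain a0 where a0: "a0 < d" using sub[of 1] r by fastforce
  have columns: "isometric_splitting (dim_col A) CS (row_selection d')"
    unfolding dims
  proof (rule isometric_splitting_row_selection)
    show "disjoint_family_on (\<lambda>J. J) CS"
      using cc by (auto simp: CS_def disjoint_family_on_def column_compatible_def)
    show "(\<Union>J\<in>CS. J) = {..<d'}"
      using sub cover[OF a0] by (fastforce simp: CS_def)
  qed (simp add: CS_def)
  have rows: "isometric_splitting (dim_row (B J)) (K J) (\<lambda>k. row_selection d (R k))" if J: "J \<in> CS" for J
  proof -
    obtain l b where l: "l \<in> {1..r}" "J = C l" "b \<in> J" "b < d'"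
      using J sub by (fastforce simp: CS_def)
    have "isometric_splitting d (K J) (\<lambda>k. row_selection d (R k))"
    proof (rule isometric_splitting_row_selection)
      show "disjoint_family_on R (K J)"
        using disj l(3) by (fastforce simp: disjoint_family_on_def K_def)
      show "(\<Union>k\<in>K J. R k) = {..<d}"
      proof
        show "{..<d} \<subseteq> (\<Union>k\<in>K J. R k)"
        proof
          fix a assume "a \<in> {..<d}"
          then obtain k where k: "k \<in> {1..r}" "a \<in> R k" "b \<in> C k" using cover[of a b] l by auto
          then have "C k = J" using cc l unfolding column_compatible_def by blast
          with k show "a \<in> (\<Union>k\<in>K J. R k)" by (auto simp: K_def)
        qed
      qed (use sub in \<open>auto simp: K_def\<close>)
    qed (simp add: K_def)
    then show ?thesis by (simp add: B_def dims)
  qed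
  have block: "row_selection d (R k) * B J = submatrix A (R k) (C k)" if "J \<in> CS" "k \<in> K J" for J k
  proof -
    have k: "k \<in> {1..r}" "C k = J" using that by (auto simp: K_def)
    show ?thesis
      using submatrix_conv_row_selection[of "R k" A "C k"] sub[OF k(1)] dims k
      by (simp add: B_def mult_assoc_dim row_selection_simps)
  qed
  have regroup: "(\<Sum>k=1..r. f (submatrix A (R k) (C k))) = (\<Sum>J\<in>CS. \<Sum>k\<in>K J. f (row_selection d (R k) * B J))"
    for f :: "complex mat \<Rightarrow> real"
    unfolding CS_def by (subst sum.image_gen[of _ _ C]) (auto simp: K_def block CS_def intro!: sum.cong)
  have "powr_le p (\<Sum>k=1..r. gram_trace p (submatrix A (R k) (C k))) (\<Sum>J\<in>CS. gram_trace p (B J))"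
    unfolding regroup using p rows by (intro powr_le_sum gram_trace_superadditive_rows)
  also have "powr_le p \<dots> (gram_trace p A)"
    unfolding B_def using p columns by (rule gram_trace_superadditive_columns)
  finally show "powr_le p (\<Sum>k=1..r. gram_trace p (submatrix A (R k) (C k))) (gram_trace p A)" .
  have "powr_le p (gram_trace p A powr (1/p)) (\<Sum>J\<in>CS. gram_trace p (B J) powr (1/p))"
    unfolding B_def using p columns by (rule gram_trace_minkowski_columns)
  also have "powr_le p \<dots> (\<Sum>k=1..r. gram_trace p (submatrix A (R k) (C k)) powr (1/p))"
    unfolding regroup[of "\<lambda>X. gram_trace p X powr (1/p)"]
    using p rows by (intro powr_le_sum gram_trace_minkowski_rows)
  finally show "powr_le p (gram_trace p A powr (1/p))
      (\<Sum>k=1..r. gram_trace p (submatrix A (R k) (C k)) powr (1/p))" .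
qed

text \<open>Passing to the adjoint exchanges rows with columns and leaves the traces unchanged.\<close>

lemma gram_trace_compatible:
  assumes A: "A \<in> carrier_mat d d'" and bp: "block_partition d d' r R C"
    and compat: "row_compatible r R \<or> column_compatible r C" and r: "0 < r" and p: "0 < p"
  shows "powr_le p (\<Sum>k=1..r. gram_trace p (submatrix A (R k) (C k))) (gram_trace p A) \<and>
    powr_le p (gram_trace p A powr (1/p)) (\<Sum>k=1..r. gram_trace p (submatrix A (R k) (C k)) powr (1/p))"
  using compat
proof
  assume "column_compatible r C"
  then show ?thesis using gram_trace_column_compatible[OF A bp _ r p] by simp
next
  assume "row_compatible r R"
  then have "column_compatible r R" by (simp add: row_compatible_def column_compatible_def)
  note adj = gram_trace_column_compatible[OF _ block_partition_swap[OF bp] this r p, of "adj A"]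
  have "(\<Sum>k=1..r. f (gram_trace p (submatrix (adj A) (C k) (R k)))) =
      (\<Sum>k=1..r. f (gram_trace p (submatrix A (R k) (C k))))" for f :: "real \<Rightarrow> real"
    using block_partition_subset[OF bp] A p
    by (intro sum.cong refl) (simp add: submatrix_adj gram_trace_adj)
  from this[of "\<lambda>x. x"] this[of "\<lambda>x. x powr (1/p)"]
  show ?thesis using adj A p by (simp add: gram_trace_adj)
qed

theorem corollary2p5:
  fixes A :: "complex mat" and d d' r :: nat and R C :: "nat \<Rightarrow> nat set" and q :: real
  assumes "A \<in> carrier_mat d d'"
    and "block_partition d d' r R C"
    and "row_compatible r R \<or> column_compatible r C"
  shows "(2 \<le> q \<longrightarrow>
      real r powr (2/q - 1) * (\<Sum>k=1..r. (schatten_norm q (submatrix A (R k) (C k)))\<^sup>2)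
        \<le> (schatten_norm q A)\<^sup>2 \<and>
      (schatten_norm q A)\<^sup>2 \<le> (\<Sum>k=1..r. (schatten_norm q (submatrix A (R k) (C k)))\<^sup>2)) \<and>
    (0 < q \<and> q < 2 \<longrightarrow>
      real r powr (2/q - 1) * (\<Sum>k=1..r. (schatten_norm q (submatrix A (R k) (C k)))\<^sup>2)
        \<ge> (schatten_norm q A)\<^sup>2 \<and>
      (schatten_norm q A)\<^sup>2 \<ge> (\<Sum>k=1..r. (schatten_norm q (submatrix A (R k) (C k)))\<^sup>2))"
proof -
  define N where "N = (\<Sum>k=1..r. (schatten_norm q (submatrix A (R k) (C k)))\<^sup>2)"
  have main: "powr_le (q/2) (real r powr (2/q - 1) * N) ((schatten_norm q A)\<^sup>2)
      \<and> powr_le (q/2) ((schatten_norm q A)\<^sup>2) N" if q: "0 < q"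
  proof (cases "r = 0")
    case True
    then have "{..<d} \<times> {..<d'} = {}" using assms(2) by (simp add: block_partition_def)
    then have "dim_row A = 0 \<or> dim_col A = 0" using assms(1) by auto
    then have "gram_trace (q/2) A = 0" using q by (intro gram_trace_empty) auto
    then show ?thesis using True q by (simp add: N_def schatten_norm_sq)
  next
    case False
    define t where "t k = gram_trace (q/2) (submatrix A (R k) (C k))" for k
    have N: "N = (\<Sum>k=1..r. t k powr (2/q))" using q by (simp add: N_def t_def schatten_norm_sq)
    have block: "powr_le (q/2) (\<Sum>k=1..r. t k) (gram_trace (q/2) A)"
      "powr_le (q/2) (gram_trace (q/2) A powr (2/q)) N"
      using gram_trace_compatible[OF assms, of "q/2"] q False by (simp_all add: N t_def)
    have "powr_le (q/2) (real r powr (2/q - 1) * N) ((\<Sum>k=1..r. t k) powr (2/q))"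
      using power_mean_powr[of "q/2" "{1..r}" t] q False by (simp add: N t_def)
    also have "powr_le (q/2) \<dots> (gram_trace (q/2) A powr (2/q))"
      using block(1) q False by (intro powr_le_powr) (auto simp: t_def sum_nonneg)
    finally show ?thesis using block(2) q False by (simp add: N schatten_norm_sq)
  qed
  show ?thesis
    using main by (auto simp: powr_le_def N_def)
qed

end
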